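(* Let two triangles $\Delta=\triangle ABC$ and $\Delta'=\triangle A'B'C'$ be given. Whether $\Delta$ is equisectionally equivalent to $\Delta'$ or not can be determined using a straightedge and compass, and if the answer is affirmative, a real number $q$ such that $[T_q(\Delta)]=[\Delta']$ is compass-and-straightedge constructible.
   Context: Triangles are nondegenerate triangles in the Euclidean plane $\cong\mathbb{C}$. Two triangles are called similar if some orientation-preserving similarity of the plane carries one onto the other (labels of vertices need not be matched); $[\Delta]$ denotes the similarity class of $\Delta$. Equisection operators: for $q\in\mathbb{R}$ and a triangle $\triangle PQR$ with vertices listed anticlockwise, $T_q(\triangle PQR)=\triangle P'Q'R'$ where $P'=qQ+(1-q)R$, $Q'=qR+(1-q)P$, $R'=qP+(1-q)Q$. Equisectional equivalence is the equivalence relation on the set of triangles generated by similarity and $\{T_q\}_{q\in\mathbb{R}}$. Straightedge and compass constructions start from the six given points $A,B,C,A',B',C'$. "Can be determined using a straightedge and compass" means that finitely many construction steps produce a point and a circle (possibly degenerate to a point) such that the triangles are equisectionally equivalent if and only if the point lies on the circle. A real number $q$ is compass-and-straightedge constructible if the point $B+q(C-B)$ can be constructed from the six given points. *)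

theory Defs
  imports "HOL-Analysis.Analysis"
begin

section \<open>Triangles and equisectional equivalence\<close>

text \<open>A triangle is represented by its set of vertices in the plane \<^typ>\<open>complex\<close>, so that
  triangles carry no labelling of the vertices.\<close>

definition triangles :: "complex set set" where
  "triangles = {{P, Q, R} | P Q R. \<not> collinear {P, Q, R}}"

definition anticlockwise :: "complex \<Rightarrow> complex \<Rightarrow> complex \<Rightarrow> bool" where
  "anticlockwise P Q R \<longleftrightarrow> 0 < Im (cnj (Q - P) * (R - P))"

definition similar :: "complex set \<Rightarrow> complex set \<Rightarrow> bool" where
  "similar D D' \<longleftrightarrow> (\<exists>a b. a \<noteq> 0 \<and> D' = (\<lambda>z. a * z + b) ` D)"

definition sim_class :: "complex set \<Rightarrow> complex set set" where
  "sim_class D = {D'. similar D D'}"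

text \<open>The three anticlockwise listings of the vertices of a triangle differ by a cyclic shift, so
  the points \<open>q Q + (1 - q) R\<close> arising from all of them are the three vertices of \<open>T\<^sub>q\<close>;
  see \<open>equisection_triangle\<close> below.\<close>

definition equisection :: "real \<Rightarrow> complex set \<Rightarrow> complex set" where
  "equisection q D =
     {of_real q * Q + of_real (1 - q) * R | P Q R. D = {P, Q, R} \<and> anticlockwise P Q R}"

definition equisection_step :: "complex set \<Rightarrow> complex set \<Rightarrow> bool" where
  "equisection_step D D' \<longleftrightarrow>
     D \<in> triangles \<and> D' \<in> triangles \<and> (similar D D' \<or> (\<exists>q. D' = equisection q D))"

definition equisectionally_equivalent :: "complex set \<Rightarrow> complex set \<Rightarrow> bool" where
  "equisectionally_equivalent = equivclp equisection_step"

lemma anticlockwise_rotate: "anticlockwise P Q R \<Longrightarrow> anticlockwise Q R P"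
  by (simp add: anticlockwise_def algebra_simps)

lemma anticlockwise_swap: "anticlockwise P Q R \<Longrightarrow> \<not> anticlockwise P R Q"
  by (simp add: anticlockwise_def algebra_simps)

lemma equisection_triangle:
  assumes "anticlockwise P Q R"
  shows "equisection q {P, Q, R} =
    {of_real q * Q + of_real (1 - q) * R,
     of_real q * R + of_real (1 - q) * P,
     of_real q * P + of_real (1 - q) * Q}"
proof -
  have ne: "P \<noteq> Q" "Q \<noteq> R" "P \<noteq> R"
    using assms by (auto simp: anticlockwise_def algebra_simps)
  have rot: "anticlockwise Q R P" "anticlockwise R P Q"
    using assms anticlockwise_rotate by blast+
  have neg: "\<not> anticlockwise P R Q" "\<not> anticlockwise Q P R" "\<not> anticlockwise R Q P"
    using assms rot anticlockwise_swap by blast+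
  have sets: "{P, Q, R} = {Q, R, P}" "{P, Q, R} = {R, P, Q}"
    by auto
  have listings: "{P, Q, R} = {X, Y, Z} \<and> anticlockwise X Y Z \<longleftrightarrow>
      (X = P \<and> Y = Q \<and> Z = R) \<or> (X = Q \<and> Y = R \<and> Z = P) \<or> (X = R \<and> Y = P \<and> Z = Q)"
    (is "?L \<longleftrightarrow> ?R") for X Y Z
  proof
    assume L: ?L
    then have dis: "X \<noteq> Y" "Y \<noteq> Z" "X \<noteq> Z"
      by (auto simp: anticlockwise_def algebra_simps)
    have "X = P \<or> X = Q \<or> X = R" "Y = P \<or> Y = Q \<or> Y = R" "Z = P \<or> Z = Q \<or> Z = R"
      using L by (metis insertCI insertE singletonD)+
    then show ?R
      using L dis neg by (elim disjE) simp_all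
  next
    assume ?R
    then show ?L
      using assms rot sets by (elim disjE conjE) simp_all
  qed
  show ?thesis
    unfolding equisection_def listings by auto
qed

section \<open>Straightedge and compass constructions\<close>

text \<open>A term records a finite sequence of construction steps that refers to the given points only
  by their position. The same term can thus be carried out for different given points, and
  its course must not depend on them in any other way.\<close>

datatype point_term =
    Given nat
  | Line_Line line_term line_term
  | Line_Circle line_term circle_term
  | Circle_Circle circle_term circle_term
and line_term =
    Line_Through point_term point_term
and circle_term =
    Centre_Radius point_term point_term point_term

text \<open>The result of carrying out a term for the given points \<open>G\<close>; there is none if some step is
  impossible. A line is directed, represented by two distinct points on it; a circle is
  represented by its centre and its radius, which is the distance between two constructed points.

  To make the result unique, a fixed convention selects one of two intersection points: for a
  line and a circle, the one farther along the direction of the line; for two circles, the one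
  not lying to the right of the line directed from the first centre to the second. Exchanging
  the two points that span the line, respectively the two circles, selects the other one.
  Without such a convention the selection could itself encode the answer to the question to be
  decided.

  A circle of radius \<open>0\<close> may be the result of a construction but must not be intersected
  with anything.\<close>

inductive constructs_point :: "complex list \<Rightarrow> point_term \<Rightarrow> complex \<Rightarrow> bool"
  and constructs_line :: "complex list \<Rightarrow> line_term \<Rightarrow> complex \<Rightarrow> complex \<Rightarrow> bool"
  and constructs_circle :: "complex list \<Rightarrow> circle_term \<Rightarrow> complex \<Rightarrow> real \<Rightarrow> bool"
  for G :: "complex list"
  where
  given:
    "i < length G \<Longrightarrow> constructs_point G (Given i) (G ! i)"
| line_line:
    "\<lbrakk>constructs_line G l P Q; constructs_line G m R S;
      affine hull {P, Q} \<inter> affine hull {R, S} = {X}\<rbrakk>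
     \<Longrightarrow> constructs_point G (Line_Line l m) X"
| line_circle:
    "\<lbrakk>constructs_line G l P Q; constructs_circle G k K r; 0 < r;
      X \<in> affine hull {P, Q} \<inter> sphere K r;
      \<forall>Y \<in> affine hull {P, Q} \<inter> sphere K r. Y \<bullet> (Q - P) \<le> X \<bullet> (Q - P)\<rbrakk>
     \<Longrightarrow> constructs_point G (Line_Circle l k) X"
| circle_circle:
    "\<lbrakk>constructs_circle G k K r; constructs_circle G k' K' r'; 0 < r; 0 < r'; K \<noteq> K';
      X \<in> sphere K r \<inter> sphere K' r';
      0 \<le> Im (cnj (K' - K) * (X - K))\<rbrakk>
     \<Longrightarrow> constructs_point G (Circle_Circle k k') X"
| line_through:
    "\<lbrakk>constructs_point G p P; constructs_point G q Q; P \<noteq> Q\<rbrakk>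
     \<Longrightarrow> constructs_line G (Line_Through p q) P Q"
| centre_radius:
    "\<lbrakk>constructs_point G c K; constructs_point G u U; constructs_point G v V\<rbrakk>
     \<Longrightarrow> constructs_circle G (Centre_Radius c u v) K (dist U V)"

lemma line_circle_unique:
  fixes P Q X Y :: complex
  assumes "P \<noteq> Q" and X: "X \<in> affine hull {P, Q}" and Y: "Y \<in> affine hull {P, Q}"
    and eq: "X \<bullet> (Q - P) = Y \<bullet> (Q - P)"
  shows "X = Y"
proof -
  obtain s t where s: "X = P + s *\<^sub>R (Q - P)" and t: "Y = P + t *\<^sub>R (Q - P)"
    using X Y by (auto simp: affine_hull_2_alt)
  have "s * ((Q - P) \<bullet> (Q - P)) = t * ((Q - P) \<bullet> (Q - P))"
    using eq unfolding s t by (simp add: inner_add_left)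
  moreover have "(Q - P) \<bullet> (Q - P) \<noteq> 0"
    using assms(1) by simp
  ultimately have "s = t"
    using mult_right_cancel by blast
  then show ?thesis
    using s t by simp
qed

lemma circle_circle_unique:
  fixes K K' X Y :: complex
  assumes "K \<noteq> K'"
    and X: "X \<in> sphere K r \<inter> sphere K' r'" and Y: "Y \<in> sphere K r \<inter> sphere K' r'"
    and "0 \<le> Im (cnj (K' - K) * (X - K))" and "0 \<le> Im (cnj (K' - K) * (Y - K))"
  shows "X = Y"
proof -
  define d x y where "d = K' - K" and "x = X - K" and "y = Y - K"
  have d: "d \<noteq> 0"
    using assms(1) by (simp add: d_def)
  have n: "cmod x = cmod y"
    using X Y by (simp add: x_def y_def dist_norm norm_minus_commute)
  have n': "cmod (x - d) = cmod (y - d)"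
    using X Y by (simp add: x_def y_def d_def dist_norm norm_minus_commute)
  have sq: "(Re x)\<^sup>2 + (Im x)\<^sup>2 = (Re y)\<^sup>2 + (Im y)\<^sup>2"
    using n by (metis cmod_power2)
  have "(Re x - Re d)\<^sup>2 + (Im x - Im d)\<^sup>2 = (Re y - Re d)\<^sup>2 + (Im y - Im d)\<^sup>2"
    using n' by (metis cmod_power2 minus_complex.sel)
  with sq have re: "Re (cnj d * x) = Re (cnj d * y)"
    by (simp add: power2_eq_square algebra_simps)
  have "cmod (cnj d * x) = cmod (cnj d * y)"
    using n by (simp add: norm_mult)
  then have "(Im (cnj d * x))\<^sup>2 = (Im (cnj d * y))\<^sup>2"
    using re by (metis add_left_cancel cmod_power2)
  moreover have "0 \<le> Im (cnj d * x)" "0 \<le> Im (cnj d * y)"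
    using assms(4,5) by (simp_all add: d_def x_def y_def)
  ultimately have "Im (cnj d * x) = Im (cnj d * y)"
    by (metis power2_eq_imp_eq)
  with re have "cnj d * x = cnj d * y"
    by (rule complex_eqI)
  then show ?thesis
    using d by (simp add: x_def y_def)
qed

lemma constructs_unique:
  "constructs_point G p X \<Longrightarrow> \<forall>Y. constructs_point G p Y \<longrightarrow> Y = X"
  "constructs_line G l P Q \<Longrightarrow> \<forall>R S. constructs_line G l R S \<longrightarrow> R = P \<and> S = Q"
  "constructs_circle G k K r \<Longrightarrow> \<forall>L s. constructs_circle G k L s \<longrightarrow> L = K \<and> s = r"
proof (induction rule: constructs_point_constructs_line_constructs_circle.inducts)
  case (given i)
  then show ?case
    by (auto elim: constructs_point.cases)
next
  case (line_line l P Q m R S X)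
  show ?case
  proof (intro allI impI)
    fix Y assume "constructs_point G (Line_Line l m) Y"
    then show "Y = X"
      using line_line by cases (metis singleton_inject)
  qed
next
  case (line_circle l P Q k K r X)
  show ?case
  proof (intro allI impI)
    fix Y assume "constructs_point G (Line_Circle l k) Y"
    then show "Y = X"
    proof cases
      case (line_circle P' Q' K' r')
      have [simp]: "P' = P" "Q' = Q" "K' = K" "r' = r"
        using line_circle(1,2) line_circle.IH by blast+
      have "P \<noteq> Q"
        using line_circle(1) by (auto elim: constructs_line.cases)
      moreover have "Y \<bullet> (Q - P) = X \<bullet> (Q - P)"
        using line_circle(4,5) line_circle.hyps
        by (intro order.antisym) auto
      ultimately show ?thesis
        using line_circle(4) line_circle.hyps line_circle_unique[of P Q Y X] by auto
    qed
  qed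
next
  case (circle_circle k K r k' K' r' X)
  show ?case
  proof (intro allI impI)
    fix Y assume "constructs_point G (Circle_Circle k k') Y"
    then show "Y = X"
    proof cases
      case (circle_circle L s L' s')
      have [simp]: "L = K" "s = r" "L' = K'" "s' = r'"
        using circle_circle(1,2) circle_circle.IH by blast+
      show ?thesis
        using circle_circle circle_circle.hyps circle_circle_unique[of K K' Y r r' X] by simp
    qed
  qed
next
  case (line_through p P q Q)
  show ?case
  proof (intro allI impI)
    fix R S assume "constructs_line G (Line_Through p q) R S"
    then show "R = P \<and> S = Q"
      using line_through.IH by cases blast
  qed
next
  case (centre_radius c K u U v V)
  show ?case
  proof (intro allI impI)
    fix L s assume "constructs_circle G (Centre_Radius c u v) L s"
    then show "L = K \<and> s = dist U V"
      using centre_radius.IH by cases blast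
  qed
qed

definition constructible_from :: "complex list \<Rightarrow> complex \<Rightarrow> bool" where
  "constructible_from G X \<longleftrightarrow> (\<exists>t. constructs_point G t X)"

end

(*
  For an anticlockwise listing P, Q, R put u = P + w Q + w^2 R and v = P + w^2 Q + w R with w a
  primitive cube root of unity. The quotient z = u / v, taken up to powers of w, determines the
  similarity class, and |z| < 1. The operator T_q multiplies z by a number of modulus 1, which
  runs through the whole unit circle except -1 as q varies. As z may be replaced by w z, two
  triangles are equisectionally equivalent iff |z| agrees, and then one T_q suffices.

  Decision: 1 - |z|^2 = sqrt 3 c h / |v|^2, where c is a side, h twice the altitude on it, and |v|
  the distance from the third vertex to the apex of the equilateral triangle erected on c on the
  other side. Comparing two such quotients takes three fourth proportionals of positive lengths.

  Constructibility: q is a rational function of w, z and z', and the coordinates of the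
  constructible points in the frame A = 0, B = 1 form a field.
*)
theory Submission
  imports Defs
begin

section \<open>Shapes of triangles\<close>

definition omega :: complex where
  "omega = Complex (- 1 / 2) (sqrt 3 / 2)"

lemma omega_square: "omega\<^sup>2 = - 1 - omega"
  by (simp add: omega_def complex_eq_iff power2_eq_square)

lemma cnj_omega: "cnj omega = - 1 - omega"
  by (simp add: omega_def complex_eq_iff)

lemma omega_nonzero: "omega \<noteq> 0"
  by (simp add: omega_def complex_eq_iff)

lemma norm_omega: "cmod omega = 1"
  by (simp add: omega_def norm_complex_def power2_eq_square)

text \<open>Collinearity with \<open>A\<close> means that \<open>(C - A) / (B - A)\<close> is real.
  Clearing the denominator gives the expression used in \<open>anticlockwise\<close>, so a
  noncollinear triple has one of two orientations.\<close>

lemma collinear_iff_Im: "collinear {A, B, C} \<longleftrightarrow> Im (cnj (B - A) * (C - A)) = 0"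
proof (cases "B = A")
  case False
  have "collinear {A, B, C} \<longleftrightarrow> collinear {0, B - A, C - A}"
    using collinear_3[of B A C] by (simp add: insert_commute collinear_3_expand)
  also have "\<dots> \<longleftrightarrow> Im ((C - A) / (B - A)) = 0"
    by (simp add: collinear_iff_Reals complex_is_Real_iff)
  also have "\<dots> \<longleftrightarrow> Im (cnj (B - A) * (C - A)) = 0"
    by (simp only: Im_complex_div_eq_0 mult.commute)
  finally show ?thesis .
qed simp

lemma anticlockwise_not_collinear: "anticlockwise P Q R \<Longrightarrow> \<not> collinear {P, Q, R}"
  by (simp add: anticlockwise_def collinear_iff_Im)

lemma not_collinear_anticlockwise:
  assumes "\<not> collinear {A, B, C}"
  shows "anticlockwise A B C \<or> anticlockwise B A C"
  using assms by (auto simp: collinear_iff_Im anticlockwise_def algebra_simps)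

section \<open>Fourier coefficients and shapes of listings\<close>

text \<open>The nontrivial discrete Fourier coefficients of the listing \<open>P, Q, R\<close>; anticlockwise
  listings are those in which \<open>pos_part\<close> dominates.\<close>

definition pos_part :: "complex \<Rightarrow> complex \<Rightarrow> complex \<Rightarrow> complex" where
  "pos_part P Q R = P + omega\<^sup>2 * Q + omega * R"

definition neg_part :: "complex \<Rightarrow> complex \<Rightarrow> complex \<Rightarrow> complex" where
  "neg_part P Q R = P + omega * Q + omega\<^sup>2 * R"

text \<open>Translations change only the remaining coefficient \<open>P + Q + R\<close>, while
  rotations and scalings multiply both parts by a common factor. The quotient is therefore the
  similarity invariant of a listing.\<close>

definition shape :: "complex \<Rightarrow> complex \<Rightarrow> complex \<Rightarrow> complex" where
  "shape P Q R = neg_part P Q R / pos_part P Q R"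

text \<open>Both squares are quadratic forms in the vertices. They share their symmetric terms, so
  that only a multiple of the signed area survives.\<close>

lemma norm_parts_diff:
  "(cmod (pos_part P Q R))\<^sup>2 - (cmod (neg_part P Q R))\<^sup>2
    = 2 * sqrt 3 * Im (cnj (Q - P) * (R - P))"
proof -
  \<comment> \<open>Naming the root makes it an atom whose only relation is
    \<open>s * s = 3\<close>, which leaves a polynomial identity.\<close>
  define s where "s = sqrt 3"
  have s: "s * s = 3" "s * (s * x) = 3 * x" for x
    by (simp_all add: s_def)
  show ?thesis
    unfolding pos_part_def neg_part_def omega_square unfolding omega_def cmod_power2 s_def[symmetric]
    by (simp add: power2_eq_square field_simps s)
qed

lemma anticlockwise_iff_norm_parts:
  "anticlockwise P Q R \<longleftrightarrow> cmod (neg_part P Q R) < cmod (pos_part P Q R)"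
proof -
  have "cmod (neg_part P Q R) < cmod (pos_part P Q R)
      \<longleftrightarrow> (cmod (neg_part P Q R))\<^sup>2 < (cmod (pos_part P Q R))\<^sup>2"
    by (meson norm_ge_zero power2_less_imp_less power_strict_mono zero_less_numeral)
  also have "\<dots> \<longleftrightarrow> 0 < 2 * sqrt 3 * Im (cnj (Q - P) * (R - P))"
    using norm_parts_diff[of P Q R] by linarith
  also have "\<dots> \<longleftrightarrow> anticlockwise P Q R"
    unfolding anticlockwise_def by (simp add: zero_less_mult_iff)
  finally show ?thesis
    by simp
qed

lemma pos_part_nonzero: "anticlockwise P Q R \<Longrightarrow> pos_part P Q R \<noteq> 0"
  by (auto simp: anticlockwise_iff_norm_parts)

lemma one_minus_norm_shape_square:
  assumes "anticlockwise P Q R"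
  shows "1 - (cmod (shape P Q R))\<^sup>2
    = 2 * sqrt 3 * Im (cnj (Q - P) * (R - P)) / (cmod (pos_part P Q R))\<^sup>2"
  using pos_part_nonzero[OF assms]
  unfolding shape_def norm_divide power_divide norm_parts_diff[symmetric] diff_divide_distrib
  by simp

text \<open>A cyclic shift of the listing multiplies the two Fourier coefficients by different
  powers of \<open>omega\<close>. An unlabelled triangle thus fixes its shape only up to such
  powers.\<close>

lemma shape_rotate: "shape Q R P = omega * shape P Q R"
proof -
  have "neg_part Q R P = omega\<^sup>2 * neg_part P Q R" "pos_part Q R P = omega * pos_part P Q R"
    unfolding neg_part_def pos_part_def using omega_square by algebra+
  then show ?thesis
    using omega_nonzero by (simp add: shape_def power2_eq_square)
qed

lemma norm_shape_rotate: "cmod (shape Q R P) = cmod (shape P Q R)"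
  by (subst shape_rotate) (simp add: norm_mult norm_omega)

lemma parts_affine:
  "pos_part (a * P + b) (a * Q + b) (a * R + b) = a * pos_part P Q R"
  "neg_part (a * P + b) (a * Q + b) (a * R + b) = a * neg_part P Q R"
  unfolding neg_part_def pos_part_def using omega_square by algebra+

lemma shape_affine:
  "a \<noteq> 0 \<Longrightarrow> shape (a * P + b) (a * Q + b) (a * R + b) = shape P Q R"
  by (simp add: shape_def parts_affine)

lemma anticlockwise_affine:
  "a \<noteq> 0 \<Longrightarrow> anticlockwise (a * P + b) (a * Q + b) (a * R + b) \<longleftrightarrow> anticlockwise P Q R"
  by (simp add: anticlockwise_iff_norm_parts parts_affine norm_mult)

lemma Im_cnj_mult_scale: "Im (cnj (z * d) * (w * d)) = (cmod d)\<^sup>2 * Im (cnj z * w)"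
  unfolding cmod_power2 by (simp add: power2_eq_square algebra_simps)

text \<open>In the frame with \<open>P\<close> at 0 and \<open>Q\<close> at 1,
  \<open>pos_part\<close> has modulus \<open>cmod (x + omega)\<close>. The point
  \<open>- omega\<close> is the apex of the equilateral triangle on the base, on the side away from
  \<open>x\<close>, so the right-hand side consists of constructible lengths.\<close>

lemma shape_over_base:
  fixes P Q x :: complex
  defines "R \<equiv> P + x * (Q - P)"
  assumes "P \<noteq> Q" "0 < Im x"
  shows "anticlockwise P Q R"
    and "1 - (cmod (shape P Q R))\<^sup>2 = 2 * sqrt 3 * Im x / (cmod (x + omega))\<^sup>2"
proof -
  have im: "Im (cnj (Q - P) * (R - P)) = (cmod (Q - P))\<^sup>2 * Im x"
    using Im_cnj_mult_scale[of 1 "Q - P" x] by (simp add: R_def)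
  then show acw: "anticlockwise P Q R"
    using assms by (simp add: anticlockwise_def)
  have "pos_part P Q R = omega * ((Q - P) * (x + omega))"
    unfolding pos_part_def R_def using omega_square by algebra
  then have "(cmod (pos_part P Q R))\<^sup>2 = (cmod (Q - P))\<^sup>2 * (cmod (x + omega))\<^sup>2"
    by (simp add: norm_mult norm_omega power_mult_distrib)
  then show "1 - (cmod (shape P Q R))\<^sup>2 = 2 * sqrt 3 * Im x / (cmod (x + omega))\<^sup>2"
    unfolding one_minus_norm_shape_square[OF acw] im using \<open>P \<noteq> Q\<close> by simp
qed

text \<open>Fourier inversion: equal quotients give one factor \<open>a\<close> for both
  coefficients, and the translation \<open>b\<close> adjusts the remaining one, the sum of the
  vertices.\<close>

lemma similar_of_shape_eq:
  assumes acw: "anticlockwise P Q R" "anticlockwise P' Q' R'"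
    and eq: "shape P Q R = shape P' Q' R'"
  shows "similar {P, Q, R} {P', Q', R'}"
proof -
  define a where "a = pos_part P' Q' R' / pos_part P Q R"
  define b where "b = (P' + Q' + R' - a * (P + Q + R)) / 3"
  note nz = pos_part_nonzero[OF acw(1)] pos_part_nonzero[OF acw(2)]
  have a: "a \<noteq> 0"
    using nz by (simp add: a_def)
  have pos: "pos_part P' Q' R' = a * pos_part P Q R"
    using nz by (simp add: a_def)
  have neg: "neg_part P' Q' R' = a * neg_part P Q R"
    using eq nz by (simp add: a_def shape_def field_simps)
  have b: "3 * b = P' + Q' + R' - a * (P + Q + R)"
    by (simp add: b_def)
  \<comment> \<open>Recovering a vertex from the coefficients divides by 3; keeping this factor
    leaves consequences of polynomial identities.\<close>
  have "3 * P' = 3 * (a * P + b)" "3 * Q' = 3 * (a * Q + b)" "3 * R' = 3 * (a * R + b)"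
    using pos neg b omega_square unfolding pos_part_def neg_part_def by algebra+
  then have "P' = a * P + b" "Q' = a * Q + b" "R' = a * R + b"
    by (simp_all only: mult_cancel_left) simp_all
  then have "{P', Q', R'} = (\<lambda>z. a * z + b) ` {P, Q, R}"
    by simp
  with a show ?thesis
    unfolding similar_def by blast
qed

lemma similar_sym:
  assumes "similar D D'"
  shows "similar D' D"
proof -
  obtain a b where a: "a \<noteq> 0" and D': "D' = (\<lambda>z. a * z + b) ` D"
    using assms by (auto simp: similar_def)
  have "D = (\<lambda>z. (1 / a) * z + (- b / a)) ` D'"
    unfolding D' image_image using a by (simp add: field_simps)
  with a show ?thesis
    unfolding similar_def by (intro exI[of _ "1 / a"] exI[of _ "- b / a"]) simp
qed

lemma similar_trans:
  assumes "similar D D'" "similar D' D''"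
  shows "similar D D''"
proof -
  obtain a b c d where "a \<noteq> 0" "D' = (\<lambda>z. a * z + b) ` D" "c \<noteq> 0" "D'' = (\<lambda>z. c * z + d) ` D'"
    using assms by (auto simp: similar_def)
  then have "D'' = (\<lambda>z. (c * a) * z + (c * b + d)) ` D" "c * a \<noteq> 0"
    by (simp_all add: image_image algebra_simps)
  then show ?thesis
    unfolding similar_def by blast
qed

lemma sim_class_eq: "similar D D' \<Longrightarrow> sim_class D = sim_class D'"
  unfolding sim_class_def using similar_sym similar_trans by blast

section \<open>The modulus of the shape as an invariant of triangles\<close>

lemma anticlockwise_listing_cases:
  assumes "{X, Y, Z} = {P, Q, R}" "anticlockwise X Y Z" "anticlockwise P Q R"
  shows "(X = P \<and> Y = Q \<and> Z = R) \<or> (X = Q \<and> Y = R \<and> Z = P) \<or> (X = R \<and> Y = P \<and> Z = Q)"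
proof -
  have "X \<noteq> Y" "Y \<noteq> Z" "X \<noteq> Z"
    using assms(2) by (auto simp: anticlockwise_def algebra_simps)
  moreover have "\<not> anticlockwise P R Q" "\<not> anticlockwise Q P R" "\<not> anticlockwise R Q P"
    using assms(3) anticlockwise_rotate anticlockwise_swap by blast+
  moreover have "X = P \<or> X = Q \<or> X = R" "Y = P \<or> Y = Q \<or> Y = R" "Z = P \<or> Z = Q \<or> Z = R"
    using assms(1) by (metis insertCI insertE singletonD)+
  ultimately show ?thesis
    using assms(2) by (elim disjE) simp_all
qed

text \<open>A relation, since the shape itself depends on the listing and sets other than triangles
  have none. Having a modulus thus doubles as being a triangle.\<close>

definition has_modulus :: "complex set \<Rightarrow> real \<Rightarrow> bool" where
  "has_modulus D \<rho> \<longleftrightarrow>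
     (\<exists>P Q R. D = {P, Q, R} \<and> anticlockwise P Q R \<and> cmod (shape P Q R) = \<rho>)"

lemma has_modulusI:
  "anticlockwise P Q R \<Longrightarrow> has_modulus {P, Q, R} (cmod (shape P Q R))"
  unfolding has_modulus_def by blast

lemma has_modulus_nonneg: "has_modulus D \<rho> \<Longrightarrow> 0 \<le> \<rho>"
  unfolding has_modulus_def by auto

lemma has_modulus_unique:
  assumes "has_modulus D \<rho>" "has_modulus D \<sigma>"
  shows "\<rho> = \<sigma>"
proof -
  obtain P Q R X Y Z where *: "D = {P, Q, R}" "anticlockwise P Q R" "cmod (shape P Q R) = \<rho>"
    "D = {X, Y, Z}" "anticlockwise X Y Z" "cmod (shape X Y Z) = \<sigma>"
    using assms unfolding has_modulus_def by blast
  have "{X, Y, Z} = {P, Q, R}"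
    using * by simp
  from anticlockwise_listing_cases[OF this *(5,2)] show ?thesis
    using *(3,6) by (metis norm_shape_rotate)
qed

lemma triangles_has_modulus: "D \<in> triangles \<longleftrightarrow> (\<exists>\<rho>. has_modulus D \<rho>)"
proof
  assume "D \<in> triangles"
  then obtain P Q R where D: "D = {P, Q, R}" "\<not> collinear {P, Q, R}"
    by (auto simp: triangles_def)
  moreover have "{P, Q, R} = {Q, P, R}"
    by auto
  ultimately show "\<exists>\<rho>. has_modulus D \<rho>"
    using not_collinear_anticlockwise[of P Q R] by (metis has_modulusI)
next
  assume "\<exists>\<rho>. has_modulus D \<rho>"
  then show "D \<in> triangles"
    unfolding has_modulus_def triangles_def using anticlockwise_not_collinear by blast
qed

lemma has_modulus_similar:
  assumes "has_modulus D \<rho>" "similar D D'"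
  shows "has_modulus D' \<rho>"
proof -
  obtain P Q R a b where *: "D = {P, Q, R}" "anticlockwise P Q R" "cmod (shape P Q R) = \<rho>"
      "a \<noteq> 0" "D' = (\<lambda>z. a * z + b) ` D"
    using assms unfolding has_modulus_def similar_def by blast
  then show ?thesis
    using has_modulusI[of "a * P + b" "a * Q + b" "a * R + b"]
    by (simp add: anticlockwise_affine shape_affine)
qed

section \<open>The action of equisection on shapes\<close>

definition equi_multiplier :: "real \<Rightarrow> complex" where
  "equi_multiplier q = of_real q * omega + of_real (1 - q) * omega\<^sup>2"

lemma equi_multiplier_eq: "equi_multiplier q = Complex (- 1 / 2) (sqrt 3 * (2 * q - 1) / 2)"
  unfolding equi_multiplier_def omega_square unfolding omega_def
  by (simp add: complex_eq_iff field_simps)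

lemma cnj_equi_multiplier:
  "cnj (equi_multiplier q) = of_real q * omega\<^sup>2 + of_real (1 - q) * omega"
  by (simp add: equi_multiplier_def omega_square cnj_omega)

lemma equi_multiplier_nonzero: "equi_multiplier q \<noteq> 0"
  by (simp add: equi_multiplier_eq complex_eq_iff)

text \<open>\<open>T_q\<close> is a real combination of cyclic shifts, so the Fourier transform
  diagonalises it, with conjugate eigenvalues on the two nontrivial coefficients.\<close>

lemma equisection_parts:
  fixes P Q R :: complex and q :: real
  defines "P' \<equiv> of_real q * Q + of_real (1 - q) * R"
    and "Q' \<equiv> of_real q * R + of_real (1 - q) * P"
    and "R' \<equiv> of_real q * P + of_real (1 - q) * Q"
  shows "pos_part P' Q' R' = equi_multiplier q * pos_part P Q R"
    and "neg_part P' Q' R' = cnj (equi_multiplier q) * neg_part P Q R"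
  unfolding cnj_equi_multiplier unfolding assms pos_part_def neg_part_def equi_multiplier_def
  using omega_square by algebra+

text \<open>Conjugate eigenvalues scale both coefficients equally in modulus: the orientation
  survives, and the shape is multiplied by a number on the unit circle.\<close>

lemma equisection_shape:
  fixes P Q R :: complex and q :: real
  assumes "anticlockwise P Q R"
  obtains P' Q' R' where "equisection q {P, Q, R} = {P', Q', R'}" "anticlockwise P' Q' R'"
    "shape P' Q' R' = cnj (equi_multiplier q) / equi_multiplier q * shape P Q R"
proof (rule that[OF equisection_triangle[OF assms, of q]])
  show "anticlockwise (of_real q * Q + of_real (1 - q) * R) (of_real q * R + of_real (1 - q) * P)
     (of_real q * P + of_real (1 - q) * Q)"
    using assms equi_multiplier_nonzero[of q]
    unfolding anticlockwise_iff_norm_parts equisection_parts norm_mult complex_mod_cnj by simp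
  show "shape (of_real q * Q + of_real (1 - q) * R) (of_real q * R + of_real (1 - q) * P)
     (of_real q * P + of_real (1 - q) * Q) = cnj (equi_multiplier q) / equi_multiplier q * shape P Q R"
    unfolding shape_def equisection_parts by simp
qed

lemma has_modulus_equisection:
  assumes "has_modulus D \<rho>"
  shows "has_modulus (equisection q D) \<rho>"
proof -
  obtain P Q R where D: "D = {P, Q, R}" "anticlockwise P Q R" "cmod (shape P Q R) = \<rho>"
    using assms unfolding has_modulus_def by blast
  obtain P' Q' R' where *: "equisection q {P, Q, R} = {P', Q', R'}" "anticlockwise P' Q' R'"
    "shape P' Q' R' = cnj (equi_multiplier q) / equi_multiplier q * shape P Q R"
    using equisection_shape[OF D(2)] .
  have "cmod (shape P' Q' R') = \<rho>"
    using *(3) D(3) equi_multiplier_nonzero[of q] by (simp add: norm_mult norm_divide)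
  then show ?thesis
    using has_modulusI[OF *(2)] *(1) D(1) by simp
qed

text \<open>An equivalence, because the generated relation also traverses steps backwards. That
  direction follows from uniqueness: the modulus of \<open>D\<close> exists and is passed on to
  \<open>D'\<close>.\<close>

lemma equisection_step_modulus:
  assumes "equisection_step D D'"
  shows "has_modulus D \<rho> \<longleftrightarrow> has_modulus D' \<rho>"
proof -
  have "has_modulus D' \<sigma>" if "has_modulus D \<sigma>" for \<sigma>
    using assms that has_modulus_similar has_modulus_equisection
    unfolding equisection_step_def by blast
  moreover have "\<exists>\<sigma>. has_modulus D \<sigma>"
    using assms triangles_has_modulus unfolding equisection_step_def by blast
  ultimately show ?thesis
    using has_modulus_unique by blast
qed

lemma equisectionally_equivalent_modulus:
  assumes "equisectionally_equivalent D D'"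
  shows "has_modulus D \<rho> \<longleftrightarrow> has_modulus D' \<rho>"
  using assms unfolding equisectionally_equivalent_def
proof (induction rule: equivclp_induct)
  case (step D' D'')
  then have "has_modulus D' \<rho> \<longleftrightarrow> has_modulus D'' \<rho>"
    by (metis equisection_step_modulus)
  with step.IH show ?case
    by (rule trans)
qed (rule refl)

text \<open>\<open>equi_multiplier q\<close> runs through the line \<open>Re w = - 1 / 2\<close>, so \<open>cnj w / w\<close> takes every value
  on the unit circle except \<open>- 1\<close>.\<close>

lemma equi_multiplier_solve:
  assumes "cmod l = 1" "l \<noteq> - 1"
  obtains q where "cnj (equi_multiplier q) / equi_multiplier q = l"
    "of_real q = (1 + (l - 1) / ((l + 1) * (omega - omega\<^sup>2))) / 2"
proof -
  define x y where "x = Re l" and "y = Im l"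
  have l: "l = Complex x y"
    by (simp add: x_def y_def)
  have xy: "x * x + y * y = 1"
    using assms(1) unfolding l by (simp add: cmod_def power2_eq_square)
  have x: "x + 1 \<noteq> 0"
  proof
    assume "x + 1 = 0"
    then have "x = - 1"
      by simp
    moreover with xy have "y = 0"
      by simp
    ultimately show False
      using assms(2) by (simp add: l complex_eq_iff)
  qed
  \<comment> \<open>If \<open>l\<close> has argument t, then \<open>y / (x + 1)\<close> is tan (t /
    2), and \<open>q\<close> solves \<open>sqrt 3 * (2 * q - 1) = y / (x + 1)\<close>.\<close>
  define q where "q = (1 + y / ((x + 1) * sqrt 3)) / 2"
  have w: "equi_multiplier q = Complex (- 1 / 2) (y / (x + 1) / 2)"
  proof -
    have "sqrt 3 * (2 * q - 1) = y / (x + 1)"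
      using x by (simp add: q_def add_divide_distrib)
    then show ?thesis
      by (simp add: equi_multiplier_eq)
  qed
  have "cnj (equi_multiplier q) = l * equi_multiplier q"
    unfolding w l using x xy by (simp add: complex_eq_iff field_simps)
  then have 1: "cnj (equi_multiplier q) / equi_multiplier q = l"
    using equi_multiplier_nonzero[of q] by (simp add: field_simps)
  have den: "omega - omega\<^sup>2 = \<i> * of_real (sqrt 3)"
    unfolding omega_square by (simp add: omega_def complex_eq_iff)
  \<comment> \<open>The Cayley transform \<open>(l - 1) / (l + 1)\<close> is \<open>\<i>\<close>
    times the same tangent. This presents \<open>q\<close> as a rational expression in
    \<open>l\<close> and \<open>omega\<close>, as needed for constructibility.\<close>
  have num: "l - 1 = (l + 1) * (\<i> * of_real (y / (x + 1)))"
    unfolding l using x xy by (simp add: complex_eq_iff field_simps)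
  have "l + 1 \<noteq> 0"
    using x by (simp add: l complex_eq_iff)
  then have "(l - 1) / ((l + 1) * (omega - omega\<^sup>2)) = of_real (y / (x + 1) / sqrt 3)"
    unfolding den num by simp
  then have "of_real q = (1 + (l - 1) / ((l + 1) * (omega - omega\<^sup>2))) / 2"
    by (simp add: q_def)
  with 1 that show ?thesis
    by blast
qed

text \<open>Some \<open>T_q\<close> supplies the unimodular ratio of the two shapes. The formula for
  \<open>q\<close> is kept for constructibility; the ratio is undefined exactly for equilateral
  triangles.\<close>

lemma equisection_reaches:
  assumes "anticlockwise P Q R" "anticlockwise X Y Z"
    and mod: "cmod (shape P Q R) = cmod (shape X Y Z)"
  obtains (generic) q P' Q' R' where "shape P Q R \<noteq> 0"
      "{P', Q', R'} = {X, Y, Z}"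
      "similar (equisection q {P, Q, R}) {X, Y, Z}"
      "of_real q = (1 + (shape P' Q' R' / shape P Q R - 1) /
         ((shape P' Q' R' / shape P Q R + 1) * (omega - omega\<^sup>2))) / 2"
    | (equilateral) "similar (equisection 0 {P, Q, R}) {X, Y, Z}"
proof (cases "shape P Q R = 0")
  case True
  \<comment> \<open>Both shapes vanish, so every parameter works; 0 is taken.\<close>
  obtain P' Q' R' where *: "equisection 0 {P, Q, R} = {P', Q', R'}" "anticlockwise P' Q' R'"
    "shape P' Q' R' = cnj (equi_multiplier 0) / equi_multiplier 0 * shape P Q R"
    using equisection_shape[OF assms(1)] .
  then have "similar {P', Q', R'} {X, Y, Z}"
    using similar_of_shape_eq assms True by simp
  then show ?thesis
    using * equilateral by simp
next
  case False
  \<comment> \<open>The ratio \<open>- 1\<close> is never attained. If it occurs, the next listing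
    of the target multiplies it by \<open>omega\<close>.\<close>
  obtain P' Q' R' where X: "{P', Q', R'} = {X, Y, Z}" "anticlockwise P' Q' R'"
      and m: "cmod (shape P' Q' R') = cmod (shape X Y Z)"
      and ne: "shape P' Q' R' \<noteq> - shape P Q R"
  proof (cases "shape X Y Z = - shape P Q R")
    case True
    have "omega \<noteq> 1"
      by (simp add: omega_def complex_eq_iff)
    with True False have "shape Y Z X \<noteq> - shape P Q R"
      by (subst shape_rotate) simp
    then show ?thesis
      using that[of Y Z X] anticlockwise_rotate[OF assms(2)]
      by (metis insert_commute norm_shape_rotate)
  qed (use that assms in blast)
  define l where "l = shape P' Q' R' / shape P Q R"
  have "cmod l = 1"
    using False by (simp add: l_def norm_divide m mod[symmetric])
  moreover have "l \<noteq> - 1"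
    using ne False by (simp add: l_def field_simps)
  ultimately obtain q where q: "cnj (equi_multiplier q) / equi_multiplier q = l"
    "of_real q = (1 + (l - 1) / ((l + 1) * (omega - omega\<^sup>2))) / 2"
    using equi_multiplier_solve by blast
  obtain U V W where *: "equisection q {P, Q, R} = {U, V, W}" "anticlockwise U V W"
    "shape U V W = cnj (equi_multiplier q) / equi_multiplier q * shape P Q R"
    using equisection_shape[OF assms(1)] .
  then have "shape U V W = shape P' Q' R'"
    using q(1) False by (simp add: l_def)
  then have "similar (equisection q {P, Q, R}) {X, Y, Z}"
    using similar_of_shape_eq[OF *(2) X(2)] * X(1) by simp
  then show ?thesis
    using generic[OF False X(1)] q(2) unfolding l_def by simp
qed

text \<open>Necessity is the invariance of the modulus; for sufficiency one equisection followed by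
  a similarity is enough.\<close>

lemma equisectionally_equivalent_iff_modulus:
  assumes "has_modulus D \<rho>" "has_modulus D' \<sigma>"
  shows "equisectionally_equivalent D D' \<longleftrightarrow> \<rho> = \<sigma>"
proof
  assume "equisectionally_equivalent D D'"
  then show "\<rho> = \<sigma>"
    using assms equisectionally_equivalent_modulus has_modulus_unique by blast
next
  assume "\<rho> = \<sigma>"
  obtain P Q R X Y Z where D: "D = {P, Q, R}" "anticlockwise P Q R" "cmod (shape P Q R) = \<rho>"
    "D' = {X, Y, Z}" "anticlockwise X Y Z" "cmod (shape X Y Z) = \<sigma>"
    using assms unfolding has_modulus_def by blast
  have "cmod (shape P Q R) = cmod (shape X Y Z)"
    using D \<open>\<rho> = \<sigma>\<close> by simp
  then obtain q where q: "similar (equisection q D) D'"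
    using equisection_reaches[OF D(2,5)] D(1,4) by metis
  have tri: "D \<in> triangles" "equisection q D \<in> triangles" "D' \<in> triangles"
    using assms has_modulus_equisection triangles_has_modulus by blast+
  then have "equisection_step D (equisection q D)" "equisection_step (equisection q D) D'"
    using q unfolding equisection_step_def by blast+
  then show "equisectionally_equivalent D D'"
    unfolding equisectionally_equivalent_def by (meson equivclp_trans r_into_equivclp)
qed

section \<open>Constructions\<close>

lemma constructs_line_circle:
  assumes l: "constructs_line G l P Q" and k: "constructs_circle G k K r" and "0 < r"
    and K: "K = P + of_real s * (Q - P)"
  shows "constructs_point G (Line_Circle l k) (K + of_real (r / cmod (Q - P)) * (Q - P))"
proof -
  define X where "X = K + of_real (r / cmod (Q - P)) * (Q - P)"
  have "P \<noteq> Q"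
    using l by (auto elim: constructs_line.cases)
  then have d: "cmod (Q - P) \<noteq> 0"
    by simp
  have "X = P + (s + r / cmod (Q - P)) *\<^sub>R (Q - P)"
    by (simp add: X_def K scaleR_conv_of_real algebra_simps)
  then have hull: "X \<in> affine hull {P, Q}"
    unfolding affine_hull_2_alt by blast
  have XK: "X - K = (r / cmod (Q - P)) *\<^sub>R (Q - P)"
    by (simp add: X_def scaleR_conv_of_real)
  then have "cmod (X - K) = r"
    using d \<open>0 < r\<close> by simp
  then have sphere: "X \<in> sphere K r"
    by (simp add: dist_norm norm_minus_commute)
  \<comment> \<open>Cauchy-Schwarz is sharp in the direction of the line, so \<open>X\<close>, one
    radius ahead of the centre, is the point that the convention selects.\<close>
  have max: "Y \<bullet> (Q - P) \<le> X \<bullet> (Q - P)" if "Y \<in> sphere K r" for Y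
  proof -
    have "(Y - K) \<bullet> (Q - P) \<le> norm (Y - K) * norm (Q - P)"
      by (rule norm_cauchy_schwarz)
    also have "\<dots> = r * cmod (Q - P)"
      using that by (simp add: dist_norm norm_minus_commute)
    also have "\<dots> = (X - K) \<bullet> (Q - P)"
      unfolding XK inner_scaleR_left power2_norm_eq_inner[symmetric] using d
      by (simp add: power2_eq_square)
    finally show ?thesis
      by (simp add: inner_diff_left)
  qed
  show ?thesis
    unfolding X_def[symmetric]
    using l k \<open>0 < r\<close> hull sphere max by (intro line_circle) auto
qed

lemma constructs_line_line:
  assumes l: "constructs_line G l P Q" and m: "constructs_line G m R S"
    and X: "X = P + of_real s * (Q - P)" "X = R + of_real t * (S - R)"
    and par: "Im (cnj (Q - P) * (S - R)) \<noteq> 0"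
  shows "constructs_point G (Line_Line l m) X"
proof (rule line_line[OF l m])
  have hull: "Y \<in> affine hull {U, V} \<longleftrightarrow> (\<exists>w. Y = U + of_real w * (V - U))" for U V Y :: complex
    by (auto simp: affine_hull_2_alt scaleR_conv_of_real)
  have eq: "Y = X" if Y: "Y = P + of_real y * (Q - P)" "Y = R + of_real z * (S - R)" for Y y z
  proof -
    have diff: "of_real (y - s) * (Q - P) = of_real (z - t) * (S - R)"
    proof -
      have "of_real (y - s) * (Q - P) = Y - X"
        unfolding X(1) Y(1) by (simp add: algebra_simps)
      also have "\<dots> = of_real (z - t) * (S - R)"
        unfolding X(2) Y(2) by (simp add: algebra_simps)
      finally show ?thesis .
    qed
    \<comment> \<open>The cross product with \<open>Q - P\<close> annihilates multiples of this
      direction and isolates \<open>z - t\<close>.\<close>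
    have "0 = Im (cnj (Q - P) * (of_real (y - s) * (Q - P)))"
      by (simp add: algebra_simps)
    also have "\<dots> = (z - t) * Im (cnj (Q - P) * (S - R))"
      unfolding diff by (simp add: algebra_simps)
    finally have "z = t"
      using par by simp
    then show ?thesis
      using X(2) Y(2) by simp
  qed
  have "Y = X" if "Y \<in> affine hull {P, Q}" "Y \<in> affine hull {R, S}" for Y
    using that eq unfolding hull by blast
  moreover have "X \<in> affine hull {P, Q}" "X \<in> affine hull {R, S}"
    using X unfolding hull by blast+
  ultimately show "affine hull {P, Q} \<inter> affine hull {R, S} = {X}"
    by blast
qed

text \<open>The apex of the triangle congruent to \<open>p q r\<close> to the left of the line from \<open>p\<close> to \<open>q\<close>;
  \<open>upper_apex q p r\<close> is its mirror image.\<close>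

definition upper_apex :: "point_term \<Rightarrow> point_term \<Rightarrow> point_term \<Rightarrow> point_term" where
  "upper_apex p q r = Circle_Circle (Centre_Radius p p r) (Centre_Radius q q r)"

definition equilateral_apex :: "point_term \<Rightarrow> point_term \<Rightarrow> point_term" where
  "equilateral_apex p q = Circle_Circle (Centre_Radius p p q) (Centre_Radius q q p)"

text \<open>The two circles determine the apex only up to reflection in \<open>A B\<close>, and the
  convention keeps the left one; hence the absolute value. Since \<open>Im x\<close> is nonzero,
  both radii are positive.\<close>

lemma constructs_upper_apex:
  assumes p: "constructs_point G p A" and q: "constructs_point G q B"
    and r: "constructs_point G r (A + x * (B - A))"
    and "A \<noteq> B" "Im x \<noteq> 0"
  shows "constructs_point G (upper_apex p q r) (A + Complex (Re x) \<bar>Im x\<bar> * (B - A))"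
proof -
  define y where "y = Complex (Re x) \<bar>Im x\<bar>"
  have nx: "cmod y = cmod x" "cmod (1 - y) = cmod (1 - x)"
    by (simp_all add: y_def cmod_def)
  have A: "dist A (A + z * (B - A)) = cmod z * cmod (B - A)" for z
    by (simp add: dist_norm norm_mult norm_minus_commute)
  have B: "dist B (A + z * (B - A)) = cmod (1 - z) * cmod (B - A)" for z
  proof -
    have "B - (A + z * (B - A)) = (1 - z) * (B - A)"
      by (simp add: algebra_simps)
    then show ?thesis
      by (simp add: dist_norm norm_mult)
  qed
  have x: "x \<noteq> 0" "x \<noteq> 1"
    using \<open>Im x \<noteq> 0\<close> by auto
  have "0 \<le> (cmod (B - A))\<^sup>2 * Im y"
    by (simp add: y_def)
  then have im: "0 \<le> Im (cnj (B - A) * ((A + y * (B - A)) - A))"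
    using Im_cnj_mult_scale[of 1 "B - A" y] by (simp only: add_diff_cancel_left' mult_1 complex_cnj_one)
  show ?thesis
    unfolding upper_apex_def y_def[symmetric]
  proof (rule circle_circle[OF centre_radius[OF p p r] centre_radius[OF q q r]])
    show "A + y * (B - A) \<in> sphere A (dist A (A + x * (B - A))) \<inter> sphere B (dist B (A + x * (B - A)))"
      unfolding Int_iff mem_sphere A B nx by simp
  qed (use \<open>A \<noteq> B\<close> x im in \<open>simp_all add: A B\<close>)
qed

text \<open>Exchanging the ends of the base replaces \<open>x\<close> by \<open>1 - x\<close> and
  left by right.\<close>

lemma constructs_lower_apex:
  assumes p: "constructs_point G p A" and q: "constructs_point G q B"
    and r: "constructs_point G r (A + x * (B - A))"
    and "A \<noteq> B" "Im x \<noteq> 0"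
  shows "constructs_point G (upper_apex q p r) (A + Complex (Re x) (- \<bar>Im x\<bar>) * (B - A))"
proof -
  have "A + x * (B - A) = B + (1 - x) * (A - B)"
    by (simp add: algebra_simps)
  then have "constructs_point G (upper_apex q p r) (B + Complex (Re (1 - x)) \<bar>Im (1 - x)\<bar> * (A - B))"
    using constructs_upper_apex[OF q p, of r "1 - x"] r \<open>A \<noteq> B\<close> \<open>Im x \<noteq> 0\<close> by simp
  moreover have "Complex (Re (1 - x)) \<bar>Im (1 - x)\<bar> = 1 - Complex (Re x) (- \<bar>Im x\<bar>)"
    by (simp add: complex_eq_iff)
  moreover have "B + (1 - z) * (A - B) = A + z * (B - A)" for z
    by (simp add: algebra_simps)
  ultimately show ?thesis
    by (simp only:)
qed

lemma constructs_equilateral_apex: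
  assumes p: "constructs_point G p A" and q: "constructs_point G q B" and "A \<noteq> B"
  shows "constructs_point G (equilateral_apex p q) (A + Complex (1 / 2) (sqrt 3 / 2) * (B - A))"
proof -
  \<comment> \<open>A primitive sixth root of unity: \<open>z\<close> and \<open>1 - z\<close> both
    have modulus 1.\<close>
  define z where "z = Complex (1 / 2) (sqrt 3 / 2)"
  have z: "cmod z = 1" "cmod (1 - z) = 1"
    by (simp_all add: z_def cmod_def power2_eq_square)
  have "B - (A + z * (B - A)) = (1 - z) * (B - A)"
    by (simp add: algebra_simps)
  then have B: "dist B (A + z * (B - A)) = dist B A"
    by (simp add: dist_norm norm_mult z)
  have A: "dist A (A + z * (B - A)) = dist A B"
    by (simp add: dist_norm norm_mult z norm_minus_commute)
  have "0 \<le> (cmod (B - A))\<^sup>2 * Im z"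
    by (simp add: z_def)
  then have im: "0 \<le> Im (cnj (B - A) * ((A + z * (B - A)) - A))"
    using Im_cnj_mult_scale[of 1 "B - A" z] by (simp only: add_diff_cancel_left' mult_1 complex_cnj_one)
  show ?thesis
    unfolding equilateral_apex_def z_def[symmetric]
  proof (rule circle_circle[OF centre_radius[OF p p q] centre_radius[OF q q p]])
    show "A + z * (B - A) \<in> sphere A (dist A B) \<inter> sphere B (dist B A)"
      unfolding Int_iff mem_sphere A B by simp
  qed (use \<open>A \<noteq> B\<close> im in simp_all)
qed

section \<open>Terms for laying off lengths and for proportions\<close>

definition forwards :: "point_term \<Rightarrow> point_term \<Rightarrow> point_term \<Rightarrow> point_term" where
  "forwards c u v = Line_Circle (Line_Through (Given 0) (Given 1)) (Centre_Radius c u v)"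

definition backwards :: "point_term \<Rightarrow> point_term \<Rightarrow> point_term \<Rightarrow> point_term" where
  "backwards c u v = Line_Circle (Line_Through (Given 1) (Given 0)) (Centre_Radius c u v)"

text \<open>For \<open>c\<close> on the line \<open>A B\<close>, the equilateral triangle on the
  base of length \<open>2\<close> centred at \<open>c\<close> has its apex on the perpendicular
  through \<open>c\<close>, at height \<open>sqrt 3\<close>.\<close>

definition above :: "point_term \<Rightarrow> point_term" where
  "above c = equilateral_apex (backwards c (Given 0) (Given 1)) (forwards c (Given 0) (Given 1))"

definition upright :: "point_term \<Rightarrow> point_term \<Rightarrow> point_term \<Rightarrow> point_term" where
  "upright c u v = Line_Circle (Line_Through c (above c)) (Centre_Radius c u v)"

definition downright :: "point_term \<Rightarrow> point_term \<Rightarrow> point_term \<Rightarrow> point_term" where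
  "downright c u v = Line_Circle (Line_Through (above c) c) (Centre_Radius c u v)"

text \<open>With unit \<open>\<bar>AB\<bar>\<close> and coordinates in which \<open>A = 0\<close>, \<open>B = 1\<close>: for positive lengths \<open>l\<close>, \<open>m\<close>, \<open>n\<close>
  the points \<open>l\<close> and \<open>l - n + \<i> m\<close> are always distinct, and their line meets the imaginary axis in
  \<open>\<i> l m / n\<close>.\<close>

definition fourth_proportional ::
  "point_term \<times> point_term \<Rightarrow> point_term \<times> point_term \<Rightarrow> point_term \<times> point_term \<Rightarrow> point_term" where
  "fourth_proportional l m n =
     (let L = forwards (Given 0) (fst l) (snd l);
          M = upright (backwards L (fst n) (snd n)) (fst m) (snd m)
      in Line_Line (Line_Through L M) (Line_Through (Given 0) (above (Given 0))))"

section \<open>Evaluation of terms in the frame with A = 0 and B = 1\<close>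

locale frame =
  fixes G :: "complex list" and A B :: complex
  assumes given_A: "constructs_point G (Given 0) A"
    and given_B: "constructs_point G (Given 1) B"
    and A_neq_B: "A \<noteq> B"
begin

definition locates :: "point_term \<Rightarrow> complex \<Rightarrow> bool" where
  "locates t z \<longleftrightarrow> constructs_point G t (A + z * (B - A))"

text \<open>A length in units of \<open>A B\<close>, carried by endpoints anywhere in the plane.
  Positivity is included because circles of radius 0 must not be intersected.\<close>

definition spans :: "point_term \<Rightarrow> point_term \<Rightarrow> real \<Rightarrow> bool" where
  "spans u v r \<longleftrightarrow> 0 < r \<and>
     (\<exists>U V. constructs_point G u U \<and> constructs_point G v V \<and> dist U V = r * dist A B)"

lemma locates_0: "locates (Given 0) 0"
  by (simp add: locates_def given_A)

lemma locates_1: "locates (Given 1) 1"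
  using given_B by (simp add: locates_def)

lemma dist_frame: "dist (A + z * (B - A)) (A + w * (B - A)) = cmod (z - w) * dist A B"
proof -
  have "(A + z * (B - A)) - (A + w * (B - A)) = (z - w) * (B - A)"
    by (simp add: algebra_simps)
  then show ?thesis
    by (simp add: dist_norm norm_mult norm_minus_commute)
qed

lemma spans_locates: "locates u z \<Longrightarrow> locates v w \<Longrightarrow> z \<noteq> w \<Longrightarrow> spans u v (cmod (z - w))"
  unfolding locates_def spans_def using dist_frame by (metis zero_less_norm_iff right_minus_eq)

lemma spans_unit: "spans (Given 0) (Given 1) 1"
  using spans_locates[OF locates_0 locates_1] by simp

lemma locates_line_circle:
  assumes "locates p z" "locates q w" "z \<noteq> w" "locates c x" "spans u v r" "x = z + of_real s * (w - z)"
  shows "locates (Line_Circle (Line_Through p q) (Centre_Radius c u v))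
           (x + of_real (r / cmod (w - z)) * (w - z))"
proof -
  obtain U V where UV: "constructs_point G u U" "constructs_point G v V" "dist U V = r * dist A B"
      "0 < r"
    using assms(5) by (auto simp: spans_def)
  have l: "constructs_line G (Line_Through p q) (A + z * (B - A)) (A + w * (B - A))"
    using assms A_neq_B by (auto simp: locates_def intro: line_through)
  have k: "constructs_circle G (Centre_Radius c u v) (A + x * (B - A)) (r * dist A B)"
    unfolding UV(3)[symmetric] using assms(4) UV(1,2) unfolding locates_def by (rule centre_radius)
  have diff: "A + w * (B - A) - (A + z * (B - A)) = (w - z) * (B - A)"
    by (simp add: algebra_simps)
  have "constructs_point G (Line_Circle (Line_Through p q) (Centre_Radius c u v))
    (A + x * (B - A) + of_real (r * dist A B / cmod ((w - z) * (B - A))) * ((w - z) * (B - A)))"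
    using constructs_line_circle[OF l k, of s] UV(4) A_neq_B unfolding diff
    by (simp add: assms(6) algebra_simps)
  moreover have "r * dist A B / cmod ((w - z) * (B - A)) = r / cmod (w - z)"
    using A_neq_B by (simp add: norm_mult dist_norm norm_minus_commute)
  moreover have "A + (x + c * (w - z)) * (B - A) = A + x * (B - A) + c * ((w - z) * (B - A))" for c
    by (simp add: algebra_simps)
  ultimately show ?thesis
    unfolding locates_def by (simp only:)
qed

lemma locates_forwards:
  assumes "locates c (of_real x)" "spans u v r"
  shows "locates (forwards c u v) (of_real (x + r))"
  using locates_line_circle[OF locates_0 locates_1 _ assms, of x] by (simp add: forwards_def)

lemma locates_backwards:
  assumes "locates c (of_real x)" "spans u v r"
  shows "locates (backwards c u v) (of_real (x - r))"
  \<comment> \<open>On the line directed from 1 to 0, the centre \<open>x\<close> has parameter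
    \<open>1 - x\<close>.\<close>
  using locates_line_circle[OF locates_1 locates_0 _ assms, of "1 - x"] by (simp add: backwards_def)

lemma locates_above:
  assumes "locates c (of_real x)"
  shows "locates (above c) (Complex x (sqrt 3))"
proof -
  note b = locates_backwards[OF assms spans_unit] and f = locates_forwards[OF assms spans_unit]
  have "locates (above c) (of_real (x - 1) + Complex (1 / 2) (sqrt 3 / 2) * 2)"
    using constructs_equilateral_apex[OF b[unfolded locates_def] f[unfolded locates_def]] A_neq_B
    unfolding above_def locates_def by (simp add: algebra_simps)
  moreover have "of_real (x - 1) + Complex (1 / 2) (sqrt 3 / 2) * 2 = Complex x (sqrt 3)"
    by (simp add: complex_eq_iff)
  ultimately show ?thesis
    by simp
qed

lemma locates_upright:
  assumes "locates c (of_real x)" "spans u v r"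
  shows "locates (upright c u v) (Complex x r)"
proof -
  have d: "Complex x (sqrt 3) - of_real x = Complex 0 (sqrt 3)"
    by (simp add: complex_eq_iff)
  have e: "of_real x + complex_of_real (r / cmod (Complex 0 (sqrt 3))) * Complex 0 (sqrt 3) = Complex x r"
    by (simp add: complex_eq_iff cmod_def)
  show ?thesis
    using locates_line_circle[OF assms(1) locates_above[OF assms(1)] _ assms, of 0]
    unfolding d e by (simp add: upright_def complex_eq_iff)
qed

lemma locates_downright:
  assumes "locates c (of_real x)" "spans u v r"
  shows "locates (downright c u v) (Complex x (- r))"
proof -
  have d: "of_real x - Complex x (sqrt 3) = Complex 0 (- sqrt 3)"
    by (simp add: complex_eq_iff)
  have e: "of_real x + complex_of_real (r / cmod (Complex 0 (- sqrt 3))) * Complex 0 (- sqrt 3) = Complex x (- r)"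
    by (simp add: complex_eq_iff cmod_def)
  show ?thesis
    using locates_line_circle[OF locates_above[OF assms(1)] assms(1) _ assms, of 1]
    unfolding d e by (simp add: downright_def complex_eq_iff)
qed

lemma locates_line_line:
  assumes "locates p1 z1" "locates q1 w1" "z1 \<noteq> w1" "locates p2 z2" "locates q2 w2" "z2 \<noteq> w2"
    and X: "x = z1 + of_real s * (w1 - z1)" "x = z2 + of_real t * (w2 - z2)"
    and par: "Im (cnj (w1 - z1) * (w2 - z2)) \<noteq> 0"
  shows "locates (Line_Line (Line_Through p1 q1) (Line_Through p2 q2)) x"
proof -
  have diff: "A + w * (B - A) - (A + z * (B - A)) = (w - z) * (B - A)" for w z
    by (simp add: algebra_simps)
  have l: "constructs_line G (Line_Through p1 q1) (A + z1 * (B - A)) (A + w1 * (B - A))"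
    "constructs_line G (Line_Through p2 q2) (A + z2 * (B - A)) (A + w2 * (B - A))"
    using assms A_neq_B by (auto simp: locates_def intro: line_through)
  have par': "Im (cnj ((w1 - z1) * (B - A)) * ((w2 - z2) * (B - A))) \<noteq> 0"
    unfolding Im_cnj_mult_scale using par A_neq_B by simp
  show ?thesis
    unfolding locates_def
  proof (rule constructs_line_line[OF l])
    show "A + x * (B - A) = A + z1 * (B - A) + of_real s * (A + w1 * (B - A) - (A + z1 * (B - A)))"
      unfolding X(1) by (simp add: algebra_simps)
    show "A + x * (B - A) = A + z2 * (B - A) + of_real t * (A + w2 * (B - A) - (A + z2 * (B - A)))"
      unfolding X(2) by (simp add: algebra_simps)
  qed (use par' in \<open>unfold diff\<close>)
qed

lemma locates_fourth_proportional:
  assumes l: "spans l1 l2 x" and m: "spans m1 m2 y" and n: "spans n1 n2 z"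
  shows "locates (fourth_proportional (l1, l2) (m1, m2) (n1, n2)) (Complex 0 (x * y / z))"
proof -
  define L where "L = forwards (Given 0) l1 l2"
  define M where "M = upright (backwards L n1 n2) m1 m2"
  have pos: "0 < x" "0 < y" "0 < z"
    using assms by (simp_all add: spans_def)
  have L: "locates L (of_real x)"
    unfolding L_def using locates_forwards[OF _ l, of "Given 0" 0] locates_0 by simp
  have M: "locates M (Complex (x - z) y)"
    unfolding M_def using locates_upright[OF locates_backwards[OF L n] m] by simp
  have N: "locates (above (Given 0)) (Complex 0 (sqrt 3))"
    using locates_above[of "Given 0" 0] locates_0 by simp
  \<comment> \<open>From \<open>x\<close>, the direction \<open>- z + \<i> y\<close> reaches the
    imaginary axis after \<open>x / z\<close> steps; \<open>t\<close> measures the height there in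
    units of \<open>sqrt 3\<close>.\<close>
  have "locates (Line_Line (Line_Through L M) (Line_Through (Given 0) (above (Given 0)))) (Complex 0 (x * y / z))"
    by (rule locates_line_line[OF L M _ locates_0 N, where s = "x / z" and t = "x * y / (z * sqrt 3)"])
      (use pos in \<open>simp_all add: complex_eq_iff field_simps\<close>)
  then show ?thesis
    by (simp add: fourth_proportional_def L_def M_def Let_def)
qed

lemma spans_fourth_proportional:
  assumes "spans l1 l2 x" "spans m1 m2 y" "spans n1 n2 z"
  shows "spans (Given 0) (fourth_proportional (l1, l2) (m1, m2) (n1, n2)) (x * y / z)"
proof -
  have "0 < x" "0 < y" "0 < z"
    using assms by (simp_all add: spans_def)
  then show ?thesis
    using spans_locates[OF locates_0 locates_fourth_proportional[OF assms]]
    by (simp add: complex_eq_iff cmod_def abs_mult)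
qed

lemma spansI:
  assumes "constructs_point G u U" "constructs_point G v V" "0 < dist U V"
  shows "spans u v (dist U V / dist A B)"
  unfolding spans_def using assms A_neq_B by fastforce

text \<open>Only positive lengths are extracted from a triangle, so that every later step can be carried out
  wherever the two triangles lie relative to each other. Mirroring the third vertex to the
  left of the first side makes the construction independent of the orientation.\<close>

lemma spans_triangle:
  assumes p: "constructs_point G p P" and q: "constructs_point G q Q" and r: "constructs_point G r R"
    and tri: "\<not> collinear {P, Q, R}"
  obtains c h v \<rho> where "spans p q c" "spans (upper_apex p q r) (upper_apex q p r) h"
    "spans (upper_apex p q r) (equilateral_apex q p) v"
    "has_modulus {P, Q, R} \<rho>" "1 - \<rho>\<^sup>2 = sqrt 3 * (c * h / v\<^sup>2)"
proof -
  define d where "d = dist A B"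
  define e where "e = Q - P"
  define x where "x = (R - P) / (Q - P)"
  define y where "y = Complex (Re x) \<bar>Im x\<bar>"
  have d: "0 < d"
    using A_neq_B by (simp add: d_def)
  have "P \<noteq> Q"
    using tri by auto
  then have e: "0 < cmod e"
    by (simp add: e_def)
  have R: "R = P + x * (Q - P)" "R = Q + (1 - x) * (P - Q)"
    using \<open>P \<noteq> Q\<close> by (simp_all add: x_def field_simps)
  have "Im (cnj (Q - P) * (R - P)) = (cmod (Q - P))\<^sup>2 * Im x"
    using Im_cnj_mult_scale[of 1 "Q - P" x] by (simp add: R)
  then have x: "Im x \<noteq> 0"
    using tri by (auto simp: collinear_iff_Im)
  have up: "constructs_point G (upper_apex p q r) (P + y * e)"
    using constructs_upper_apex[OF p q _ \<open>P \<noteq> Q\<close> x, of r] r by (simp add: R(1)[symmetric] y_def e_def)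
  have low: "constructs_point G (upper_apex q p r) (P + cnj y * e)"
    using constructs_lower_apex[OF p q _ \<open>P \<noteq> Q\<close> x, of r] r
    by (simp add: R(1)[symmetric] y_def e_def complex_cnj)
  \<comment> \<open>Reversing the base puts the equilateral apex on the side opposite to the
    mirrored third vertex \<open>P + y * e\<close>.\<close>
  have "Q + Complex (1 / 2) (sqrt 3 / 2) * (P - Q) = P - omega * e"
  proof -
    have "Complex (1 / 2) (sqrt 3 / 2) = 1 + omega"
      by (simp add: omega_def complex_eq_iff)
    then show ?thesis
      by (simp add: e_def algebra_simps)
  qed
  then have eq: "constructs_point G (equilateral_apex q p) (P - omega * e)"
    using constructs_equilateral_apex[OF q p] \<open>P \<noteq> Q\<close> by simp
  have v: "dist (P + y * e) (P - omega * e) = cmod (y + omega) * cmod e"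
    by (simp add: dist_norm norm_mult[symmetric] algebra_simps)
  have "y - cnj y = Complex 0 (2 * \<bar>Im x\<bar>)"
    by (simp add: y_def complex_eq_iff)
  then have "cmod (y - cnj y) = 2 * \<bar>Im x\<bar>"
    by (simp add: cmod_def real_sqrt_mult)
  then have h: "dist (P + y * e) (P + cnj y * e) = 2 * \<bar>Im x\<bar> * cmod e"
    by (simp add: dist_norm left_diff_distrib[symmetric] norm_mult)
  have "0 < Im (y + omega)"
    using x by (simp add: y_def omega_def add_nonneg_pos)
  then have y: "y + omega \<noteq> 0"
    by (metis less_irrefl zero_complex.sel(2))
  have "dist P Q = cmod e"
    by (simp add: e_def dist_norm norm_minus_commute)
  then have 1: "spans p q (cmod e / d)"
    unfolding d_def using spansI[OF p q] e by simp
  have 2: "spans (upper_apex p q r) (upper_apex q p r) (2 * \<bar>Im x\<bar> * cmod e / d)"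
    unfolding d_def using spansI[OF up low] e x unfolding h by simp
  have 3: "spans (upper_apex p q r) (equilateral_apex q p) (cmod (y + omega) * cmod e / d)"
    unfolding d_def using spansI[OF up eq] e y unfolding v by simp
  have "\<exists>\<rho>. has_modulus {P, Q, R} \<rho> \<and> 1 - \<rho>\<^sup>2 = 2 * sqrt 3 * \<bar>Im x\<bar> / (cmod (y + omega))\<^sup>2"
  proof (cases "0 < Im x")
    case True
    then have "y = x"
      by (simp add: y_def complex_eq_iff)
    then show ?thesis
      using shape_over_base[OF \<open>P \<noteq> Q\<close> True] has_modulusI True unfolding R(1)[symmetric] by auto
  next
    \<comment> \<open>For a clockwise listing \<open>P\<close> and \<open>Q\<close> are exchanged.
      The new coordinate \<open>1 - x\<close> is the reflection of \<open>y\<close> in the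
      perpendicular bisector of the base, which fixes \<open>- omega\<close>.\<close>
    case False
    then have pos: "0 < Im (1 - x)"
      using x by simp
    have "1 - x + omega = - cnj (y + omega)"
      using False by (simp add: y_def omega_def complex_eq_iff)
    then have "cmod (1 - x + omega) = cmod (y + omega)"
      by (simp only: norm_minus_cancel complex_mod_cnj)
    moreover have "{P, Q, R} = {Q, P, R}"
      by auto
    moreover have "Im (1 - x) = \<bar>Im x\<bar>"
      using False by simp
    ultimately show ?thesis
      using shape_over_base[OF \<open>P \<noteq> Q\<close>[symmetric] pos] has_modulusI
      unfolding R(2)[symmetric] by metis
  qed
  then obtain \<rho> where "has_modulus {P, Q, R} \<rho>"
    "1 - \<rho>\<^sup>2 = 2 * sqrt 3 * \<bar>Im x\<bar> / (cmod (y + omega))\<^sup>2"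
    by blast
  \<comment> \<open>The quotient is free of scale, so the unit \<open>d\<close> and the side
    \<open>cmod e\<close> cancel.\<close>
  moreover have "2 * sqrt 3 * \<bar>Im x\<bar> / (cmod (y + omega))\<^sup>2 =
      sqrt 3 * (cmod e / d * (2 * \<bar>Im x\<bar> * cmod e / d) / (cmod (y + omega) * cmod e / d)\<^sup>2)"
    using d e y by (simp add: power2_eq_square field_simps)
  ultimately show ?thesis
    using that[OF 1 2 3] by simp
qed

section \<open>The field of constructible coordinates\<close>

definition coords :: "complex set" where
  "coords = {z. \<exists>t. locates t z}"

lemma coordsI: "locates t z \<Longrightarrow> z \<in> coords"
  unfolding coords_def by blast

lemma coords_iff: "z \<in> coords \<longleftrightarrow> constructible_from G (A + z * (B - A))"
  by (simp add: coords_def locates_def constructible_from_def)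

lemma coords_0: "0 \<in> coords" and coords_1: "1 \<in> coords"
  using locates_0 locates_1 by (blast intro: coordsI)+

lemma coords_spans:
  assumes "x \<in> coords" "x \<noteq> 0"
  obtains t where "spans (Given 0) t (cmod x)"
  using assms spans_locates[OF locates_0, of _ x] unfolding coords_def by fastforce

lemma coords_shift:
  assumes "of_real x \<in> coords" "spans u v r" "\<bar>s\<bar> = r"
  shows "of_real (x + s) \<in> coords"
proof -
  obtain t where t: "locates t (of_real x)"
    using assms(1) by (auto simp: coords_def)
  show ?thesis
    using coordsI[OF locates_forwards[OF t assms(2)]] coordsI[OF locates_backwards[OF t assms(2)]] assms(3)
    by (auto simp: abs_if split: if_splits)
qed

lemma coords_of_spans: "spans u v r \<Longrightarrow> \<bar>s\<bar> = r \<Longrightarrow> of_real s \<in> coords"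
  using coords_shift[of 0 u v r s] coords_0 by simp

lemma coords_real_add:
  assumes "of_real x \<in> coords" "of_real y \<in> coords"
  shows "of_real (x + y) \<in> coords"
\<comment> \<open>Zero is split off because it is not the length of any
  \<open>spans\<close>.\<close>
proof (cases "y = 0")
  case False
  then obtain t where "spans (Given 0) t \<bar>y\<bar>"
    using coords_spans[OF assms(2)] by auto
  then show ?thesis
    using coords_shift[OF assms(1)] by blast
qed (use assms in simp)

text \<open>The fourth proportional of the absolute values, with the sign supplied by the direction
  of laying off. If an operand vanishes, the value is 0 by the convention for division.\<close>

lemma coords_real_mult_divide:
  assumes "of_real x \<in> coords" "of_real y \<in> coords" "of_real z \<in> coords"
  shows "of_real (x * y / z) \<in> coords"
proof (cases "x = 0 \<or> y = 0 \<or> z = 0")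
  case False
  then obtain t u v where "spans (Given 0) t \<bar>x\<bar>" "spans (Given 0) u \<bar>y\<bar>" "spans (Given 0) v \<bar>z\<bar>"
    using coords_spans[OF assms(1)] coords_spans[OF assms(2)] coords_spans[OF assms(3)]
    by (metis norm_of_real of_real_eq_0_iff)
  from coords_of_spans[OF spans_fourth_proportional[OF this], of "x * y / z"] show ?thesis
    by (simp add: abs_mult)
qed (use coords_0 in auto)

lemma coords_Complex:
  assumes "of_real x \<in> coords" "of_real y \<in> coords"
  shows "Complex x y \<in> coords"
proof (cases "y = 0")
  case True
  then show ?thesis
    using assms by (simp add: complex_of_real_def)
next
  case False
  then obtain u where u: "spans (Given 0) u \<bar>y\<bar>"
    using coords_spans[OF assms(2)] by auto
  obtain t where t: "locates t (of_real x)"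
    using assms(1) by (auto simp: coords_def)
  show ?thesis
    using coordsI[OF locates_upright[OF t u]] coordsI[OF locates_downright[OF t u]]
    by (simp add: abs_if split: if_splits)
qed

text \<open>The mirror images of the point in \<open>A B\<close> span the perpendicular, whose foot
  is the real part; the distance from the foot gives the imaginary part up to sign.\<close>

lemma coords_Re_Im:
  assumes "z \<in> coords"
  shows "of_real (Re z) \<in> coords \<and> of_real (Im z) \<in> coords"
proof (cases "Im z = 0")
  case True
  then have "of_real (Re z) = z" "of_real (Im z) = (0 :: complex)"
    by (simp_all add: complex_eq_iff)
  then show ?thesis
    using assms coords_0 by simp
next
  case False
  obtain t where t: "locates t z"
    using assms by (auto simp: coords_def)
  have up: "locates (upper_apex (Given 0) (Given 1) t) (Complex (Re z) \<bar>Im z\<bar>)"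
    using constructs_upper_apex[OF given_A given_B t[unfolded locates_def] A_neq_B False]
    by (simp add: locates_def)
  have low: "locates (upper_apex (Given 1) (Given 0) t) (Complex (Re z) (- \<bar>Im z\<bar>))"
    using constructs_lower_apex[OF given_A given_B t[unfolded locates_def] A_neq_B False]
    by (simp add: locates_def)
  have foot: "locates (Line_Line (Line_Through (upper_apex (Given 0) (Given 1) t)
      (upper_apex (Given 1) (Given 0) t)) (Line_Through (Given 0) (Given 1))) (of_real (Re z))"
    by (rule locates_line_line[OF up low _ locates_0 locates_1, where s = "1 / 2" and t = "Re z"])
      (use False in \<open>simp_all add: complex_eq_iff\<close>)
  have "of_real (Re z) \<noteq> z"
    using False by (simp add: complex_eq_iff)
  from spans_locates[OF foot t this] have "of_real (Im z) \<in> coords"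
    by (rule coords_of_spans) (simp add: cmod_def)
  with foot show ?thesis
    by (blast intro: coordsI)
qed

lemma coords_minus: "z \<in> coords \<Longrightarrow> - z \<in> coords"
proof -
  have "of_real (- 1) \<in> coords"
    using coords_of_spans[OF spans_unit, of "- 1"] by simp
  then have "of_real (- x) \<in> coords" if "of_real x \<in> coords" for x
    using coords_real_mult_divide[of "- 1" x 1] that coords_1 by simp
  then show "- z \<in> coords" if "z \<in> coords"
    using coords_Complex[of "- Re z" "- Im z"] coords_Re_Im[OF that]
    by (metis complex_surj uminus_complex.code)
qed

lemma coords_add: "z \<in> coords \<Longrightarrow> w \<in> coords \<Longrightarrow> z + w \<in> coords"
  using coords_Complex[OF coords_real_add coords_real_add, of "Re z" "Re w" "Im z" "Im w"]
    coords_Re_Im[of z] coords_Re_Im[of w] by (simp add: plus_complex.code)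

lemma coords_diff: "z \<in> coords \<Longrightarrow> w \<in> coords \<Longrightarrow> z - w \<in> coords"
  using coords_add[OF _ coords_minus, of z w] by simp

lemma coords_real_mult: "of_real x \<in> coords \<Longrightarrow> of_real y \<in> coords \<Longrightarrow> of_real (x * y) \<in> coords"
  using coords_real_mult_divide[of x y 1] coords_1 by simp

lemma coords_mult:
  assumes "z \<in> coords" "w \<in> coords"
  shows "z * w \<in> coords"
proof -
  note parts = coords_Re_Im[OF assms(1)] coords_Re_Im[OF assms(2)]
  have "of_real (Re z * Re w - Im z * Im w) \<in> coords"
    using coords_diff[OF coords_real_mult coords_real_mult, of "Re z" "Re w" "Im z" "Im w"] parts by simp
  moreover have "of_real (Re z * Im w + Im z * Re w) \<in> coords"
    using coords_add[OF coords_real_mult coords_real_mult, of "Re z" "Im w" "Im z" "Re w"] parts by simp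
  ultimately show ?thesis
    using coords_Complex by (metis times_complex.code)
qed

lemma coords_divide:
  assumes "z \<in> coords" "w \<in> coords"
  shows "z / w \<in> coords"
proof -
  \<comment> \<open>The inverse is \<open>cnj w / n\<close>; for \<open>w = 0\<close> both sides are
    0.\<close>
  define n where "n = (Re w)\<^sup>2 + (Im w)\<^sup>2"
  note parts = coords_Re_Im[OF assms(2)]
  have n: "of_real n \<in> coords"
    unfolding n_def power2_eq_square using parts by (intro coords_real_add coords_real_mult) auto
  have "of_real (Re w / n) \<in> coords"
    using coords_real_mult_divide[of 1 "Re w" n] coords_1 parts n by simp
  moreover have "of_real (- Im w / n) \<in> coords"
    using coords_real_mult_divide[of 1 "- Im w" n] coords_1 coords_minus parts n by fastforce
  ultimately have "inverse w \<in> coords"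
    using coords_Complex[of "Re w / n" "- Im w / n"]
    by (simp add: n_def inverse_complex.code)
  with assms(1) show ?thesis
    unfolding divide_inverse by (rule coords_mult)
qed

lemma coords_omega: "omega \<in> coords"
proof -
  have "Complex (1 / 2) (sqrt 3 / 2) \<in> coords"
    using constructs_equilateral_apex[OF given_A given_B A_neq_B]
    by (auto simp: locates_def intro: coordsI)
  then have "Complex (1 / 2) (sqrt 3 / 2) - 1 \<in> coords"
    using coords_1 by (rule coords_diff)
  then show ?thesis
    by (simp add: omega_def minus_complex.code one_complex.code)
qed

lemma coords_given:
  assumes "constructs_point G t X"
  shows "(X - A) / (B - A) \<in> coords"
  using assms A_neq_B by (intro coordsI[of t]) (simp add: locates_def)

text \<open>By affine invariance the shape may be computed from frame coordinates, where it is a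
  rational expression over the field.\<close>

lemma coords_shape:
  assumes "\<And>X. X \<in> {P, Q, R} \<Longrightarrow> (X - A) / (B - A) \<in> coords"
  shows "shape P Q R \<in> coords"
proof -
  let ?f = "\<lambda>X. (X - A) / (B - A)"
  have f: "?f X = 1 / (B - A) * X + (- A / (B - A))" for X
    by (simp add: diff_divide_distrib)
  have "shape (?f P) (?f Q) (?f R) = shape P Q R"
    unfolding f using A_neq_B by (intro shape_affine) simp
  moreover have "shape p q r \<in> coords" if "p \<in> coords" "q \<in> coords" "r \<in> coords" for p q r
    unfolding shape_def neg_part_def pos_part_def power2_eq_square using that
    by (intro coords_divide coords_add coords_mult coords_omega)
  then have "shape (?f P) (?f Q) (?f R) \<in> coords"
    using assms by blast
  ultimately show ?thesis
    by simp
qed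

lemma constructible_ratio:
  assumes acw: "anticlockwise P Q R" "anticlockwise X Y Z"
    and mod: "cmod (shape P Q R) = cmod (shape X Y Z)"
    and constr: "\<And>V. V \<in> {P, Q, R, X, Y, Z} \<Longrightarrow> (V - A) / (B - A) \<in> coords"
  obtains q where "similar (equisection q {P, Q, R}) {X, Y, Z}" "of_real q \<in> coords"
  using acw mod
proof (cases rule: equisection_reaches)
  case (generic q P' Q' R')
  have "shape P Q R \<in> coords" "shape P' Q' R' \<in> coords"
    using constr generic(2) by (auto intro!: coords_shape)
  then have "of_real q \<in> coords"
    \<comment> \<open>Writing squares as products and 2 as \<open>1 + 1\<close> leaves field
      operations only.\<close>
    unfolding generic(4) power2_eq_square unfolding one_add_one[symmetric]
    by (intro coords_divide coords_add coords_diff coords_mult coords_omega coords_1)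
  with generic(3) that show ?thesis
    by blast
next
  case equilateral
  then show ?thesis
    using that[of 0] coords_0 by simp
qed

end

section \<open>The decision procedure and the constructible parameter\<close>

definition apex_square_term :: "point_term \<Rightarrow> point_term \<Rightarrow> point_term \<Rightarrow> point_term" where
  "apex_square_term p q r =
     (let v = (upper_apex p q r, equilateral_apex q p) in fourth_proportional v v (p, q))"

lemma constructs_given_six:
  fixes A B C A' B' C' :: complex
  defines "G \<equiv> [A, B, C, A', B', C']"
  shows "constructs_point G (Given 0) A" "constructs_point G (Given 1) B"
    "constructs_point G (Given 2) C" "constructs_point G (Given 3) A'"
    "constructs_point G (Given 4) B'" "constructs_point G (Given 5) C'"
  using given[of 0 G] given[of 1 G] given[of 2 G] given[of 3 G] given[of 4 G] given[of 5 G]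
  by (simp_all add: G_def)

text \<open>The point and circle terms are chosen before the triangles. They can always be carried
  out, as they process only positive lengths.\<close>

theorem proposition15:
  shows "(\<exists>(p :: point_term) (k :: circle_term).
            \<forall>A B C A' B' C' :: complex.
              \<not> collinear {A, B, C} \<longrightarrow> \<not> collinear {A', B', C'} \<longrightarrow>
              (\<exists>X K r. constructs_point [A, B, C, A', B', C'] p X \<and>
                        constructs_circle [A, B, C, A', B', C'] k K r \<and>
                        (equisectionally_equivalent {A, B, C} {A', B', C'} \<longleftrightarrow> X \<in> sphere K r)))
       \<and> (\<forall>A B C A' B' C' :: complex.
            \<not> collinear {A, B, C} \<longrightarrow> \<not> collinear {A', B', C'} \<longrightarrow>
            equisectionally_equivalent {A, B, C} {A', B', C'} \<longrightarrow>
            (\<exists>q :: real. sim_class (equisection q {A, B, C}) = sim_class {A', B', C'} \<and>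
                         constructible_from [A, B, C, A', B', C'] (B + of_real q * (C - B))))"
proof (rule conjI)
  \<comment> \<open>With c, h, v from \<open>spans_triangle\<close>, \<open>?s\<close> lies at
    distance v^2 / c from \<open>A\<close>. The point \<open>?p\<close> lies at distance (v^2 / c)
    h' / h and the circle \<open>?k\<close> has radius v'^2 / c', so incidence is the comparison of
    c h / v^2 with c' h' / v'^2 after cross multiplication.\<close>
  let ?s = "apex_square_term (Given 0) (Given 1) (Given 2)"
  let ?s' = "apex_square_term (Given 3) (Given 4) (Given 5)"
  let ?h = "(upper_apex (Given 0) (Given 1) (Given 2), upper_apex (Given 1) (Given 0) (Given 2))"
  let ?h' = "(upper_apex (Given 3) (Given 4) (Given 5), upper_apex (Given 4) (Given 3) (Given 5))"
  let ?p = "fourth_proportional (Given 0, ?s) ?h' ?h"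
  let ?k = "Centre_Radius (Given 0) (Given 0) ?s'"
  show "\<exists>(p :: point_term) (k :: circle_term).
            \<forall>A B C A' B' C' :: complex.
              \<not> collinear {A, B, C} \<longrightarrow> \<not> collinear {A', B', C'} \<longrightarrow>
              (\<exists>X K r. constructs_point [A, B, C, A', B', C'] p X \<and>
                        constructs_circle [A, B, C, A', B', C'] k K r \<and>
                        (equisectionally_equivalent {A, B, C} {A', B', C'} \<longleftrightarrow> X \<in> sphere K r))"
  proof (rule exI[of _ ?p], rule exI[of _ ?k], intro allI impI)
    fix A B C A' B' C' :: complex
    assume tri: "\<not> collinear {A, B, C}" and tri': "\<not> collinear {A', B', C'}"
    let ?G = "[A, B, C, A', B', C']"
    note G = constructs_given_six[of A B C A' B' C']
    interpret frame ?G A B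
      using G tri by unfold_locales auto
    obtain c h v \<rho> where s: "spans (Given 0) (Given 1) c" "spans (fst ?h) (snd ?h) h"
      "spans (fst ?h) (equilateral_apex (Given 1) (Given 0)) v"
      and \<rho>: "has_modulus {A, B, C} \<rho>" "1 - \<rho>\<^sup>2 = sqrt 3 * (c * h / v\<^sup>2)"
      using spans_triangle[OF G(1-3) tri] unfolding fst_conv snd_conv .
    obtain c' h' v' \<rho>' where s': "spans (Given 3) (Given 4) c'" "spans (fst ?h') (snd ?h') h'"
      "spans (fst ?h') (equilateral_apex (Given 4) (Given 3)) v'"
      and \<rho>': "has_modulus {A', B', C'} \<rho>'" "1 - \<rho>'\<^sup>2 = sqrt 3 * (c' * h' / v'\<^sup>2)"
      using spans_triangle[OF G(4-6) tri'] unfolding fst_conv snd_conv .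
    have pos: "0 < c" "0 < h" "0 < v" "0 < c'" "0 < h'" "0 < v'"
      using s s' by (simp_all add: spans_def)
    have "spans (Given 0) ?s (v * v / c)"
      unfolding apex_square_term_def Let_def using s by (intro spans_fourth_proportional) simp_all
    then have X: "locates ?p (Complex 0 (v * v / c * h' / h))"
      using s s' by (intro locates_fourth_proportional) simp_all
    have "locates ?s' (Complex 0 (v' * v' / c'))"
      unfolding apex_square_term_def Let_def using s' by (intro locates_fourth_proportional) simp_all
    then have k: "constructs_circle ?G ?k A (dist A (A + Complex 0 (v' * v' / c') * (B - A)))"
      unfolding locates_def by (rule centre_radius[OF G(1) G(1)])
    have dist: "dist A (A + Complex 0 x * (B - A)) = \<bar>x\<bar> * dist A B" for x
      using dist_frame[of 0 "Complex 0 x"] by (simp add: cmod_def)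
    have "A + Complex 0 (v * v / c * h' / h) * (B - A)
          \<in> sphere A (dist A (A + Complex 0 (v' * v' / c') * (B - A)))
        \<longleftrightarrow> v * v / c * h' / h = v' * v' / c'"
      unfolding mem_sphere dist mult_cancel_right using pos A_neq_B by (simp add: abs_mult)
    also have "\<dots> \<longleftrightarrow> c * h / v\<^sup>2 = c' * h' / v'\<^sup>2"
      using pos by (auto simp: field_simps power2_eq_square)
    also have "\<dots> \<longleftrightarrow> \<rho>\<^sup>2 = \<rho>'\<^sup>2"
      using \<rho>(2) \<rho>'(2) by (smt (verit) mult_cancel_left real_sqrt_eq_zero_cancel_iff)
    also have "\<dots> \<longleftrightarrow> \<rho> = \<rho>'"
      using has_modulus_nonneg[OF \<rho>(1)] has_modulus_nonneg[OF \<rho>'(1)] by (rule power2_eq_iff_nonneg)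
    also have "\<dots> \<longleftrightarrow> equisectionally_equivalent {A, B, C} {A', B', C'}"
      using equisectionally_equivalent_iff_modulus[OF \<rho>(1) \<rho>'(1)] by simp
    finally show "\<exists>X K r. constructs_point ?G ?p X \<and> constructs_circle ?G ?k K r \<and>
        (equisectionally_equivalent {A, B, C} {A', B', C'} \<longleftrightarrow> X \<in> sphere K r)"
      using X k unfolding locates_def by blast
  qed
next
  show "\<forall>A B C A' B' C' :: complex.
            \<not> collinear {A, B, C} \<longrightarrow> \<not> collinear {A', B', C'} \<longrightarrow>
            equisectionally_equivalent {A, B, C} {A', B', C'} \<longrightarrow>
            (\<exists>q :: real. sim_class (equisection q {A, B, C}) = sim_class {A', B', C'} \<and>
                         constructible_from [A, B, C, A', B', C'] (B + of_real q * (C - B)))"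
  proof (intro allI impI)
    fix A B C A' B' C' :: complex
    assume tri: "\<not> collinear {A, B, C}" and tri': "\<not> collinear {A', B', C'}"
      and equiv: "equisectionally_equivalent {A, B, C} {A', B', C'}"
    let ?G = "[A, B, C, A', B', C']"
    note G = constructs_given_six[of A B C A' B' C']
    interpret frame ?G A B
      using G tri by unfold_locales auto
    have "{A, B, C} \<in> triangles" "{A', B', C'} \<in> triangles"
      using tri tri' unfolding triangles_def by blast+
    then obtain \<rho> \<rho>' where \<rho>: "has_modulus {A, B, C} \<rho>" "has_modulus {A', B', C'} \<rho>'"
      using triangles_has_modulus by blast
    then have "\<rho> = \<rho>'"
      using equiv equisectionally_equivalent_iff_modulus by blast
    then obtain P Q R X Y Z where listings: "{A, B, C} = {P, Q, R}" "anticlockwise P Q R"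
        "{A', B', C'} = {X, Y, Z}" "anticlockwise X Y Z" "cmod (shape P Q R) = cmod (shape X Y Z)"
      using \<rho> unfolding has_modulus_def by metis
    \<comment> \<open>The anticlockwise listings only permute the given points.\<close>
    have "(V - A) / (B - A) \<in> coords" if "V \<in> {P, Q, R, X, Y, Z}" for V
    proof -
      have "V \<in> {A, B, C} \<union> {A', B', C'}"
        using that unfolding listings by blast
      then show ?thesis
        using G[THEN coords_given] by blast
    qed
    then obtain q where q: "similar (equisection q {A, B, C}) {A', B', C'}" "of_real q \<in> coords"
      using constructible_ratio[OF listings(2,4,5)] unfolding listings by blast
    \<comment> \<open>The frame coordinate of \<open>B + of_real q * (C - B)\<close>, with
      \<open>B\<close> at 1.\<close>
    have "1 + of_real q * ((C - A) / (B - A) - 1) \<in> coords"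
      by (intro coords_add coords_mult coords_diff coords_1 q coords_given[OF G(3)])
    moreover have "A + (1 + of_real q * ((C - A) / (B - A) - 1)) * (B - A) = B + of_real q * (C - B)"
      using A_neq_B by (simp add: field_simps)
    ultimately have "constructible_from ?G (B + of_real q * (C - B))"
      by (simp add: coords_iff)
    with q(1) show "\<exists>q :: real. sim_class (equisection q {A, B, C}) = sim_class {A', B', C'} \<and>
                         constructible_from ?G (B + of_real q * (C - B))"
      using sim_class_eq by blast
  qed
qed

end
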